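(* Let $f,g\colon (\mathbb{C}^n,0)\to (\mathbb{C},0)$ be two (not necessarily reduced) holomorphic function-germs, not identically zero, and let $k=\mathrm{ord}_0 g$. Let $\varphi\colon (\mathbb{C}^n,0)\to (\mathbb{C}^n,0)$ and $\phi\colon (\mathbb{C},0)\to (\mathbb{C},0)$ be two germs of mappings such that $f=\phi\circ g\circ \varphi$. Let $T=\{t_j\}_j\subset (0,+\infty)$ be a sequence with $\lim_{j} t_j=0$, and let $T'=\{t_j^k\}_j$. Assume that $\varphi$ has a pseudo-derivative $d\varphi\colon \mathbb{C}^n\to \mathbb{C}^n$ at $0$ with respect to $T$, and that $\phi$ has a pseudo-derivative $d\phi\colon \mathbb{C}\to \mathbb{C}$ at $0$ with respect to $T'$. If $d\varphi$ and $d\phi$ are homeomorphisms, then the Milnor fibres $f_*^{-1}(1)$ and $g_*^{-1}(1)$ of the initial forms of $f$ and $g$ are homotopy equivalent.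
   Context: A holomorphic function-germ $f\colon(\mathbb{C}^n,0)\to(\mathbb{C},0)$, not identically zero, is written $f=f_m+f_{m+1}+\cdots$, where each $f_j$ is identically zero or a homogeneous polynomial of degree $j$, and $f_m\neq 0$. Then $m=\mathrm{ord}_0 f$, and $f_*:=f_m$ is called the initial form of $f$. The Milnor fibre of $f_*$ is $f_*^{-1}(1)=\{x\in\mathbb{C}^n: f_*(x)=1\}$. Pseudo-derivative: let $\varphi\colon U\subset \mathbb{R}^p\to \mathbb{R}^q$ be a mapping with $0\in U$ and $\varphi(0)=0$, and let $T=\{t_j\}_j\subset (0,+\infty)$ be a sequence with $\lim t_j=0$. One says that $\varphi$ has a pseudo-derivative $\psi\colon \mathbb{R}^p\to \mathbb{R}^q$, with $\psi(0)=0$, at $0$ with respect to $T$ if $\varphi$ is continuous at $0$ and there is $r>0$ such that $B_r(0)\subset U$ and the sequence of mappings $\varphi_j\colon B_{r/t_j}(0)\to \mathbb{R}^q$, $\varphi_j(v)=\frac{\varphi(t_jv)}{t_j}$, converges uniformly on compact sets to $\psi$. Here $\mathbb{C}^n$ is identified with $\mathbb{R}^{2n}$. The mappings $\varphi,\phi$ in the statement are not assumed to be homeomorphisms. *)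

theory Defs
  imports "HOL-Complex_Analysis.Complex_Analysis"
begin

text \<open>
  A germ at the origin is represented by a total function; only its values near 0 matter.
  In several variables, holomorphic means complex differentiable, i.e. Frechet differentiable
  with complex-linear derivative, at every point of a neighbourhood of the origin.
\<close>

definition holomorphic_at_0 :: "(complex ^ 'n \<Rightarrow> complex) \<Rightarrow> bool" where
  "holomorphic_at_0 f \<longleftrightarrow>
     (\<exists>S. open S \<and> 0 \<in> S \<and>
        (\<forall>x\<in>S. \<exists>L. (f has_derivative L) (at x) \<and> (\<forall>c v. L (c *s v) = c * L v)))"

definition holomorphic_germ :: "(complex ^ 'n \<Rightarrow> complex) \<Rightarrow> bool" where
  "holomorphic_germ f \<longleftrightarrow> holomorphic_at_0 f \<and> f 0 = 0"

definition nonzero_germ :: "(complex ^ 'n \<Rightarrow> complex) \<Rightarrow> bool" where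
  "nonzero_germ f \<longleftrightarrow> \<not> (\<forall>\<^sub>F x in nhds 0. f x = 0)"

definition multi_indices :: "nat \<Rightarrow> ('n::finite \<Rightarrow> nat) set" where
  "multi_indices d = {\<alpha>. (\<Sum>i\<in>UNIV. \<alpha> i) = d}"

lemma finite_multi_indices: "finite (multi_indices d :: ('n::finite \<Rightarrow> nat) set)"
proof (rule finite_subset)
  show "multi_indices d \<subseteq> (PiE UNIV (\<lambda>_::'n. {..d}))"
    by (auto simp: multi_indices_def intro!: member_le_sum)
qed (simp add: finite_PiE)

text \<open>The zero polynomial counts as homogeneous of every degree.\<close>

definition homogeneous_polynomial :: "nat \<Rightarrow> (complex ^ 'n \<Rightarrow> complex) \<Rightarrow> bool" where
  "homogeneous_polynomial d p \<longleftrightarrow>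
     (\<exists>c. p = (\<lambda>x. \<Sum>\<alpha>\<in>multi_indices d. c \<alpha> * (\<Prod>i\<in>UNIV. (x $ i) ^ \<alpha> i)))"

definition homogeneous_expansion ::
    "(complex ^ 'n \<Rightarrow> complex) \<Rightarrow> (nat \<Rightarrow> complex ^ 'n \<Rightarrow> complex) \<Rightarrow> bool" where
  "homogeneous_expansion f F \<longleftrightarrow>
     (\<forall>j. homogeneous_polynomial j (F j)) \<and>
     (\<forall>\<^sub>F x in nhds 0. (\<lambda>j. F j x) sums f x)"

lemma homogeneous_polynomial_scale:
  assumes "homogeneous_polynomial d p"
  shows "p (z *s x) = z ^ d * p x"
proof -
  obtain c where p: "p = (\<lambda>x. \<Sum>\<alpha>\<in>multi_indices d. c \<alpha> * (\<Prod>i\<in>UNIV. (x $ i) ^ \<alpha> i))"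
    using assms by (auto simp: homogeneous_polynomial_def)
  have "(\<Prod>i\<in>UNIV. (z * x $ i) ^ \<alpha> i) = z ^ d * (\<Prod>i\<in>UNIV. (x $ i) ^ \<alpha> i)"
    if "\<alpha> \<in> multi_indices d" for \<alpha>
    using that by (simp add: multi_indices_def power_mult_distrib prod.distrib flip: power_sum)
  then show ?thesis
    by (simp add: p sum_distrib_left algebra_simps cong: sum.cong)
qed

lemma homogeneous_expansion_unique:
  fixes f :: "complex ^ 'n \<Rightarrow> complex"
  assumes "homogeneous_expansion f F" "homogeneous_expansion f G"
  shows "F = G"
proof (intro ext)
  fix j and x :: "complex ^ 'n"
  define a where "a j = F j x - G j x" for j
  have "\<forall>\<^sub>F y in nhds 0. (\<lambda>j. F j y) sums f y \<and> (\<lambda>j. G j y) sums f y"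
    using assms by (auto simp: homogeneous_expansion_def eventually_conj)
  then have "\<forall>\<^sub>F y in nhds 0. (\<lambda>j. F j y - G j y) sums 0"
    by (rule eventually_mono) (use sums_diff in fastforce)
  moreover have "((\<lambda>z. z *s x) \<longlongrightarrow> 0) (nhds 0)"
  proof -
    have "((\<lambda>z. \<chi> i. z * x $ i) \<longlongrightarrow> (\<chi> i. 0 * x $ i)) (nhds 0)"
      by (intro tendsto_intros filterlim_ident)
    then show ?thesis
      by (simp add: vector_scalar_mult_def zero_vec_def)
  qed
  ultimately have "\<forall>\<^sub>F z in nhds 0. (\<lambda>j. F j (z *s x) - G j (z *s x)) sums 0"
    by (rule eventually_compose_filterlim)
  moreover have "F j (z *s x) - G j (z *s x) = a j * z ^ j" for j z
  proof -
    have "homogeneous_polynomial j (F j)" "homogeneous_polynomial j (G j)"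
      using assms by (simp_all add: homogeneous_expansion_def)
    then show ?thesis
      by (simp add: homogeneous_polynomial_scale a_def algebra_simps)
  qed
  ultimately have "\<forall>\<^sub>F z in nhds 0. (\<lambda>j. a j * z ^ j) sums 0"
    by simp
  then obtain r where r: "r > 0" "\<And>z. norm z < r \<Longrightarrow> (\<lambda>j. a j * z ^ j) sums 0"
    by (auto simp: eventually_nhds_metric dist_norm)
  have "a j = 0"
  proof (rule ccontr)
    assume nz: "a j \<noteq> 0"
    have "a 0 = 0"
      using r(2)[of 0] r(1) by simp
    with nz have "j > 0"
      by (cases j) auto
    show False
    proof (rule powser_0_nonzero[of r 0 a "\<lambda>_. 0" j])
      fix s :: real
      assume s: "0 < s" "\<And>z::complex. z \<in> cball 0 s - {0} \<Longrightarrow> (0 :: complex) \<noteq> 0"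
      then show False
        using s(2)[of "of_real s"] by simp
    qed (use r nz \<open>j > 0\<close> in auto)
  qed
  then show "F j x = G j x"
    by (simp add: a_def)
qed

definition homogeneous_part :: "(complex ^ 'n \<Rightarrow> complex) \<Rightarrow> nat \<Rightarrow> complex ^ 'n \<Rightarrow> complex" where
  "homogeneous_part f = (THE F. homogeneous_expansion f F)"

text \<open>The order and the initial form are meaningful for holomorphic germs that are not zero.\<close>

definition ord0 :: "(complex ^ 'n \<Rightarrow> complex) \<Rightarrow> nat" where
  "ord0 f = (LEAST j. homogeneous_part f j \<noteq> (\<lambda>_. 0))"

definition initial_form :: "(complex ^ 'n \<Rightarrow> complex) \<Rightarrow> complex ^ 'n \<Rightarrow> complex" where
  "initial_form f = homogeneous_part f (ord0 f)"

definition milnor_fibre :: "(complex ^ 'n \<Rightarrow> complex) \<Rightarrow> (complex ^ 'n) set" where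
  "milnor_fibre p = {x. p x = 1}"

text \<open>
  The rescaled map at stage \<open>j\<close> is meaningful on the ball of radius \<open>r / t j\<close> only.
  Since \<open>t j\<close> tends to 0, these balls eventually contain any given compact set, so the values of
  \<open>\<phi>\<close> outside \<open>U\<close> do not affect the uniform limits.
\<close>

definition has_pseudo_derivative ::
    "'a::euclidean_space set \<Rightarrow> ('a \<Rightarrow> 'b::euclidean_space) \<Rightarrow> ('a \<Rightarrow> 'b) \<Rightarrow> (nat \<Rightarrow> real) \<Rightarrow> bool" where
  "has_pseudo_derivative U \<phi> \<psi> t \<longleftrightarrow>
     0 \<in> U \<and> \<phi> 0 = 0 \<and> (\<forall>j. t j > 0) \<and> t \<longlonglongrightarrow> 0 \<and>
     \<psi> 0 = 0 \<and> continuous (at 0 within U) \<phi> \<and>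
     (\<exists>r>0. ball 0 r \<subseteq> U \<and>
        (\<forall>K. compact K \<longrightarrow>
           uniform_limit K (\<lambda>j v. \<phi> (t j *\<^sub>R v) /\<^sub>R t j) \<psi> sequentially))"

end

theory Submission
  imports Defs
begin

text \<open>
  With \<open>m = ord0 f\<close>, \<open>f (t v) / t ^ m\<close> tends to the initial form of \<open>f\<close> at \<open>v\<close>, even when \<open>v\<close> varies
  along a convergent sequence. Rescaling \<open>f = \<Phi> \<circ> g \<circ> \<phi>\<close> therefore shows that \<open>f (t\<^sub>j v) / t\<^sub>j ^ k\<close>
  tends to \<open>d\<Phi> (g\<^sub>* (d\<phi> v))\<close>, which is not identically zero. Hence \<open>m = k\<close> and
  \<open>f\<^sub>* = d\<Phi> \<circ> g\<^sub>* \<circ> d\<phi>\<close>, so \<open>d\<phi>\<close> maps the Milnor fibre of \<open>f\<^sub>*\<close> homeomorphically onto a fibre of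
  \<open>g\<^sub>*\<close> over a nonzero value, and homogeneity rescales that fibre to the Milnor fibre of \<open>g\<^sub>*\<close>.
  The existence of the homogeneous expansion is reduced to one complex variable by restricting to
  lines: the Taylor terms are entire with polynomial growth in each variable, so they are
  polynomials by Liouville's theorem and Lagrange interpolation.
\<close>

subsection \<open>Functions polynomial in each variable separately\<close>

text \<open>The Lagrange polynomial of node \<open>a\<close> for the nodes \<open>0, ..., d\<close>;
  characteristic zero keeps the embedded nodes distinct, so the denominator is nonzero.\<close>

definition lagrange_basis :: "nat \<Rightarrow> nat \<Rightarrow> 'a::field_char_0 poly" where
  "lagrange_basis d a =
     smult (1 / (\<Prod>b\<in>{..d} - {a}. of_nat a - of_nat b)) (\<Prod>b\<in>{..d} - {a}. [:- of_nat b, 1:])"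

lemma degree_lagrange_basis:
  assumes "a \<le> d"
  shows "degree (lagrange_basis d a) \<le> d"
proof -
  have "degree (\<Prod>b\<in>{..d} - {a}. [:- of_nat b, 1::'a:]) \<le> (\<Sum>b\<in>{..d} - {a}. 1)"
    by (rule order_trans[OF degree_prod_sum_le]) auto
  also have "\<dots> = d"
    using assms by simp
  finally show ?thesis
    by (auto simp: lagrange_basis_def intro: order_trans[OF degree_smult_le])
qed

lemma poly_lagrange_basis:
  assumes "a \<le> d" "b \<le> d"
  shows "poly (lagrange_basis d a) (of_nat b) = (if a = b then 1 else 0)"
proof (cases "a = b")
  case True
  have "(\<Prod>c\<in>{..d} - {a}. of_nat a - of_nat c :: 'a) \<noteq> 0"
    by auto
  then show ?thesis
    using True by (simp add: lagrange_basis_def poly_prod)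
next
  case False
  then have "(\<Prod>c\<in>{..d} - {a}. of_nat b - of_nat c :: 'a) = 0"
    using assms by (intro prod_zero) auto
  then show ?thesis
    using False by (simp add: lagrange_basis_def poly_prod)
qed

text \<open>Both sides have degree at most \<open>d\<close> in \<open>y\<close> and agree at
  \<open>d + 1\<close> distinct nodes.\<close>

lemma lagrange_interpolation:
  fixes q :: "'a::field_char_0 poly"
  assumes "degree q \<le> d"
  shows "poly q y = (\<Sum>a\<le>d. poly q (of_nat a) * poly (lagrange_basis d a) y)"
proof -
  let ?p = "\<Sum>a\<le>d. smult (poly q (of_nat a)) (lagrange_basis d a)"
  have "q = ?p"
  proof (rule poly_eqI_degree[where A = "of_nat ` {..d}"])
    have c: "card ((of_nat :: nat \<Rightarrow> 'a) ` {..d}) = Suc d"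
      by (subst card_image) (auto simp: inj_on_def)
    show "card ((of_nat :: nat \<Rightarrow> 'a) ` {..d}) > degree q"
      using c assms by simp
    have "degree ?p \<le> d"
      by (intro degree_sum_le) (auto intro!: order_trans[OF degree_smult_le] degree_lagrange_basis)
    then show "card ((of_nat :: nat \<Rightarrow> 'a) ` {..d}) > degree ?p"
      using c by simp
    fix x :: 'a
    assume "x \<in> of_nat ` {..d}"
    then obtain b where b: "b \<le> d" "x = of_nat b"
      by auto
    have "poly ?p x = (\<Sum>a\<le>d. if a = b then poly q (of_nat a) else 0)"
      unfolding b(2) poly_sum poly_smult using b(1)
      by (intro sum.cong) (auto simp: poly_lagrange_basis)
    then show "poly q x = poly ?p x"
      using b by simp
  qed
  then have "poly q y = poly ?p y"
    by (rule arg_cong)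
  then show ?thesis
    by (simp add: poly_sum)
qed

definition separately_polynomial :: "nat \<Rightarrow> ('a::field_char_0 ^ 'n \<Rightarrow> 'a) \<Rightarrow> bool" where
  "separately_polynomial d h \<longleftrightarrow>
     (\<forall>i x. \<exists>q. degree q \<le> d \<and> (\<forall>y. h (\<chi> l. if l = i then y else x $ l) = poly q y))"

text \<open>Induction over \<open>S\<close>, one coordinate at a time: coordinates in
  \<open>S\<close> have been moved to nodes, the others keep their values.\<close>

lemma separately_polynomial_interpolation:
  fixes h :: "'a::field_char_0 ^ 'n \<Rightarrow> 'a"
  assumes h: "separately_polynomial d h" and "finite S"
  shows "h x = (\<Sum>a\<in>S \<rightarrow>\<^sub>E {..d}. h (\<chi> l. if l \<in> S then of_nat (a l) else x $ l) *
                 (\<Prod>i\<in>S. poly (lagrange_basis d (a i)) (x $ i)))"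
  using \<open>finite S\<close>
proof (induction S rule: finite_induct)
  case empty
  then show ?case by simp
next
  case (insert i S)
  let ?L = "\<lambda>a i. poly (lagrange_basis d a) (x $ i)"
  let ?y = "\<lambda>S a. \<chi> l. if l \<in> S then of_nat (a l) else x $ l"
  have expand: "h (?y S a) = (\<Sum>v\<le>d. h (?y (insert i S) (a(i := v))) * ?L v i)" for a
  proof -
    obtain q where q: "degree q \<le> d"
      "\<And>y. h (\<chi> l. if l = i then y else ?y S a $ l) = poly q y"
      using h unfolding separately_polynomial_def by meson
    have 1: "(\<chi> l. if l = i then x $ i else ?y S a $ l) = ?y S a"
      using insert by (auto simp: vec_eq_iff)
    have 2: "(\<chi> l. if l = i then of_nat v else ?y S a $ l) = ?y (insert i S) (a(i := v))" for v
      using insert by (auto simp: vec_eq_iff)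
    show ?thesis
      using lagrange_interpolation[OF q(1), of "x $ i"] unfolding q(2)[symmetric] 1 2 .
  qed
  have "h x = (\<Sum>a\<in>S \<rightarrow>\<^sub>E {..d}. \<Sum>v\<le>d. h (?y (insert i S) (a(i := v))) * ?L v i * (\<Prod>i\<in>S. ?L (a i) i))"
    by (subst insert.IH) (simp add: expand sum_distrib_right)
  also have "\<dots> = (\<Sum>(v, a)\<in>{..d} \<times> (S \<rightarrow>\<^sub>E {..d}).
                 h (?y (insert i S) (a(i := v))) * ?L v i * (\<Prod>i\<in>S. ?L (a i) i))"
    by (subst sum.swap) (simp add: sum.cartesian_product)
  \<comment> \<open>Since \<open>i \<notin> S\<close>, a pair \<open>(v, a)\<close> amounts to the
    single node assignment \<open>a(i := v)\<close> on \<open>insert i S\<close>.\<close>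
  also have "\<dots> = (\<Sum>(v, a)\<in>{..d} \<times> (S \<rightarrow>\<^sub>E {..d}).
                 h (?y (insert i S) (a(i := v))) * (\<Prod>j\<in>insert i S. ?L ((a(i := v)) j) j))"
  proof (intro sum.cong refl, clarify)
    fix v a
    have "(\<Prod>j\<in>S. ?L ((a(i := v)) j) j) = (\<Prod>j\<in>S. ?L (a j) j)"
      using insert by (intro prod.cong) auto
    then show "h (?y (insert i S) (a(i := v))) * ?L v i * (\<Prod>i\<in>S. ?L (a i) i) =
        h (?y (insert i S) (a(i := v))) * (\<Prod>j\<in>insert i S. ?L ((a(i := v)) j) j)"
      using insert by simp
  qed
  also have "\<dots> = (\<Sum>a\<in>insert i S \<rightarrow>\<^sub>E {..d}.
                 h (?y (insert i S) a) * (\<Prod>j\<in>insert i S. ?L (a j) j))"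
    unfolding PiE_insert_eq
    by (subst sum.reindex[OF inj_combinator[OF insert.hyps(2)]]) (simp add: o_def case_prod_unfold)
  finally show ?case .
qed

text \<open>Interpolating in all coordinates leaves only values of \<open>h\<close> at node vectors;
  multiplying out the basis polynomials then gives coefficients independent of
  \<open>x\<close>.\<close>

lemma separately_polynomial_monomials:
  fixes h :: "'a::field_char_0 ^ 'n \<Rightarrow> 'a"
  assumes h: "separately_polynomial d h"
  obtains c where "\<And>x. h x = (\<Sum>\<alpha>\<in>UNIV \<rightarrow>\<^sub>E {..d}. c \<alpha> * (\<Prod>i\<in>UNIV. (x $ i) ^ \<alpha> i))"
proof
  fix x :: "'a ^ 'n"
  let ?c = "\<lambda>\<alpha>. \<Sum>a\<in>UNIV \<rightarrow>\<^sub>E {..d}.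
              h (\<chi> l. of_nat (a l)) * (\<Prod>i\<in>UNIV. coeff (lagrange_basis d (a i)) (\<alpha> i))"
  have L: "poly (lagrange_basis d a) y = (\<Sum>b\<le>d. coeff (lagrange_basis d a) b * y ^ b)"
    if "a \<le> d" for a and y :: 'a
    using degree_lagrange_basis[OF that] unfolding poly_altdef
    by (intro sum.mono_neutral_left) (auto simp: coeff_eq_0)
  have "h x = (\<Sum>a\<in>UNIV \<rightarrow>\<^sub>E {..d}. h (\<chi> l. of_nat (a l)) *
                 (\<Prod>i\<in>UNIV. poly (lagrange_basis d (a i)) (x $ i)))"
    using separately_polynomial_interpolation[OF h, of UNIV x] by simp
  also have "\<dots> = (\<Sum>a\<in>UNIV \<rightarrow>\<^sub>E {..d}. h (\<chi> l. of_nat (a l)) *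
                 (\<Prod>i\<in>UNIV. \<Sum>b\<le>d. coeff (lagrange_basis d (a i)) b * (x $ i) ^ b))"
    by (intro sum.cong refl arg_cong2[where f = "(*)"] prod.cong L) (auto simp: PiE_iff)
  also have "\<dots> = (\<Sum>a\<in>UNIV \<rightarrow>\<^sub>E {..d}. \<Sum>\<alpha>\<in>UNIV \<rightarrow>\<^sub>E {..d}. h (\<chi> l. of_nat (a l)) *
                 (\<Prod>i\<in>UNIV. coeff (lagrange_basis d (a i)) (\<alpha> i)) * (\<Prod>i\<in>UNIV. (x $ i) ^ \<alpha> i))"
    by (simp add: prod_sum_PiE sum_distrib_left prod.distrib mult.assoc)
  also have "\<dots> = (\<Sum>\<alpha>\<in>UNIV \<rightarrow>\<^sub>E {..d}. ?c \<alpha> * (\<Prod>i\<in>UNIV. (x $ i) ^ \<alpha> i))"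
    by (subst sum.swap) (simp add: sum_distrib_right)
  finally show "h x = (\<Sum>\<alpha>\<in>UNIV \<rightarrow>\<^sub>E {..d}. ?c \<alpha> * (\<Prod>i\<in>UNIV. (x $ i) ^ \<alpha> i))" .
qed

lemma homogeneous_polynomial_of_separately_polynomial:
  fixes h :: "complex ^ 'n \<Rightarrow> complex"
  assumes h: "separately_polynomial d h" and hom: "\<And>z x. h (z *s x) = z ^ d * h x"
  shows "homogeneous_polynomial d h"
proof -
  let ?I = "UNIV \<rightarrow>\<^sub>E {..d} :: ('n \<Rightarrow> nat) set"
  let ?m = "\<lambda>(x :: complex ^ 'n) \<alpha>. \<Prod>i\<in>UNIV. (x $ i) ^ \<alpha> i"
  let ?deg = "\<lambda>\<alpha>. \<Sum>i\<in>UNIV. \<alpha> i"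
  obtain c where c: "\<And>x. h x = (\<Sum>\<alpha>\<in>?I. c \<alpha> * ?m x \<alpha>)"
    using separately_polynomial_monomials[OF h] by blast
  have fin: "finite ?I"
    by (intro finite_PiE) auto
  have sub: "multi_indices d \<subseteq> ?I"
    by (auto simp: multi_indices_def intro!: member_le_sum)
  have "h x = (\<Sum>\<alpha>\<in>multi_indices d. c \<alpha> * ?m x \<alpha>)" for x
  proof -
    \<comment> \<open>As a polynomial in \<open>z\<close>, \<open>h (z *s x)\<close> groups the
      monomials by total degree. It equals \<open>h x * z ^ d\<close>, so comparing coefficients of
      \<open>z ^ d\<close> selects total degree \<open>d\<close>.\<close>
    let ?p = "\<Sum>\<alpha>\<in>?I. monom (c \<alpha> * ?m x \<alpha>) (?deg \<alpha>)"
    have "poly ?p z = poly (monom (h x) d) z" for z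
    proof -
      have "poly ?p z = h (z *s x)"
        unfolding c poly_sum
        by (intro sum.cong refl)
          (simp add: poly_monom power_mult_distrib prod.distrib power_sum)
      also have "\<dots> = poly (monom (h x) d) z"
        by (simp add: hom poly_monom)
      finally show ?thesis .
    qed
    then have "poly ?p = poly (monom (h x) d)"
      by (rule ext)
    then have "coeff ?p d = coeff (monom (h x) d) d"
      by (simp only: poly_eq_poly_eq_iff)
    then have "h x = (\<Sum>\<alpha>\<in>?I. if ?deg \<alpha> = d then c \<alpha> * ?m x \<alpha> else 0)"
      by (simp add: coeff_sum)
    also have "\<dots> = (\<Sum>\<alpha>\<in>multi_indices d. c \<alpha> * ?m x \<alpha>)"
      using sub fin by (intro sum.mono_neutral_cong_right) (auto simp: multi_indices_def)
    finally show ?thesis .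
  qed
  then show ?thesis
    unfolding homogeneous_polynomial_def by blast
qed

subsection \<open>The homogeneous Taylor expansion\<close>

lemma norm_vector_scalar_mult:
  fixes x :: "'a::real_normed_field ^ 'n"
  shows "norm (c *s x) = norm c * norm x"
  by (simp add: norm_vec_def norm_mult L2_set_right_distrib)

lemma of_real_vector_scalar_mult:
  fixes x :: "'a::real_normed_field ^ 'n"
  shows "(of_real s :: 'a) *s x = s *\<^sub>R x"
  unfolding vec_eq_iff vector_smult_component vector_scaleR_component
  by (simp add: scaleR_conv_of_real)

lemma bounded_linear_vector_scalar_mult_left:
  fixes x :: "complex ^ 'n"
  shows "bounded_linear (\<lambda>z. z *s x)"
proof -
  have "linear (\<lambda>z. z *s x)"
    by (rule linearI) (simp_all add: vec_eq_iff algebra_simps)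
  then show ?thesis
    by (rule linear_conv_bounded_linear[THEN iffD1])
qed

text \<open>Complex linearity turns the chain-rule derivative \<open>h \<mapsto> L (h *s b)\<close>
  into multiplication by \<open>L b\<close>.\<close>

lemma holomorphic_on_complex_line:
  fixes f :: "complex ^ 'n \<Rightarrow> complex"
  assumes "\<And>x. x \<in> S \<Longrightarrow> \<exists>L. (f has_derivative L) (at x) \<and> (\<forall>c v. L (c *s v) = c * L v)"
  shows "(\<lambda>z. f (a + z *s b)) holomorphic_on {z. a + z *s b \<in> S}"
  unfolding holomorphic_on_def
proof
  fix z assume "z \<in> {z. a + z *s b \<in> S}"
  then obtain L where L: "(f has_derivative L) (at (a + z *s b))" "\<forall>c v. L (c *s v) = c * L v"
    using assms by blast
  have "((\<lambda>z. a + z *s b) has_derivative (\<lambda>h. h *s b)) (at z)"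
    using has_derivative_add[OF has_derivative_const
        bounded_linear_imp_has_derivative[OF bounded_linear_vector_scalar_mult_left], of a b "at z"]
    by simp
  from has_derivative_compose[OF this L(1)]
  have "((\<lambda>z. f (a + z *s b)) has_derivative (\<lambda>h. L b * h)) (at z)"
    by (simp add: L(2) mult.commute)
  then have "(\<lambda>z. f (a + z *s b)) field_differentiable at z"
    unfolding field_differentiable_def has_field_derivative_def by blast
  then show "(\<lambda>z. f (a + z *s b)) field_differentiable at z within {z. a + z *s b \<in> S}"
    by (rule field_differentiable_at_within)
qed

text \<open>What one-variable theory gives for a holomorphic germ before the \<open>F j\<close> are
  known to be polynomials. The lines in \<open>line\<close> may miss the origin, which gives access
  to single coordinates.\<close>

locale homogeneous_taylor =
  fixes f :: "complex ^ 'n \<Rightarrow> complex" and F :: "nat \<Rightarrow> complex ^ 'n \<Rightarrow> complex"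
    and \<rho> M :: real
  assumes radius_pos: "\<rho> > 0"
    and scale: "F j (c *s x) = c ^ j * F j x"
    and bound: "norm (F j x) \<le> M * (norm x / \<rho>) ^ j"
    and sums: "norm x \<le> \<rho> \<Longrightarrow> (\<lambda>j. F j x) sums f x"
    and line: "(\<lambda>z. f (a + z *s b)) holomorphic_on {z. norm (a + z *s b) < \<rho>}"

text \<open>\<open>F j x\<close> is the \<open>j\<close>-th Taylor coefficient at 0 of the slice
  \<open>z \<mapsto> f (z *s x)\<close>, and \<open>M\<close> bounds \<open>f\<close> on the closed
  ball of radius \<open>\<rho>\<close>.\<close>

lemma holomorphic_at_0_imp_homogeneous_taylor:
  fixes f :: "complex ^ 'n \<Rightarrow> complex"
  assumes "holomorphic_at_0 f"
  obtains F \<rho> M where "homogeneous_taylor f F \<rho> M"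
proof -
  obtain S where S: "open S" "0 \<in> S"
    "\<forall>x\<in>S. \<exists>L. (f has_derivative L) (at x) \<and> (\<forall>c v. L (c *s v) = c * L v)"
    using assms unfolding holomorphic_at_0_def by (elim exE conjE) blast
  obtain r where r: "r > 0" "ball 0 r \<subseteq> S"
    using S(1,2) open_contains_ball by blast
  \<comment> \<open>For \<open>norm x \<le> \<rho>\<close> the slice is then holomorphic on a disc
    of radius \<open>r / \<rho> > 1\<close>, which contains \<open>z = 1\<close>.\<close>
  define \<rho> where "\<rho> = r / 2"
  have \<rho>: "\<rho> > 0" "\<rho> < r"
    using r by (auto simp: \<rho>_def)
  have line: "(\<lambda>z. f (a + z *s b)) holomorphic_on {z. norm (a + z *s b) < r}" for a b
  proof (rule holomorphic_on_subset)
    show "(\<lambda>z. f (a + z *s b)) holomorphic_on {z. a + z *s b \<in> S}"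
      using S(3) by (intro holomorphic_on_complex_line) blast
    show "{z. norm (a + z *s b) < r} \<subseteq> {z. a + z *s b \<in> S}"
      using r(2) by auto
  qed
  have line0: "(\<lambda>z. f (z *s x)) holomorphic_on {z. norm (z *s x) < r}" for x
    using line[of 0 x] by simp
  have "continuous_on (cball 0 \<rho>) f"
  proof (intro continuous_at_imp_continuous_on ballI)
    fix x :: "complex ^ 'n" assume "x \<in> cball 0 \<rho>"
    then have "x \<in> S"
      using r(2) \<rho> by auto
    then show "isCont f x"
      using S(3) has_derivative_continuous by blast
  qed
  then have "compact (f ` cball 0 \<rho>)"
    by (intro compact_continuous_image) auto
  then obtain M where M: "\<And>x. norm x \<le> \<rho> \<Longrightarrow> norm (f x) \<le> M"
    by (force dest!: compact_imp_bounded simp: bounded_iff)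
  define F where "F j x = (deriv ^^ j) (\<lambda>z. f (z *s x)) 0 / fact j" for j x
  have open_line: "open {z. norm (z *s x) < r}" for x :: "complex ^ 'n"
    unfolding norm_vector_scalar_mult by (intro open_Collect_less continuous_intros)
  have scale: "F j (c *s x) = c ^ j * F j x" for j c x
  proof -
    have "(deriv ^^ j) (\<lambda>z. f ((c * z) *s x)) 0 = c ^ j * (deriv ^^ j) (\<lambda>z. f (z *s x)) (c * 0)"
      by (rule higher_deriv_compose_linear[OF line0[of x] open_line[of "c *s x"] open_line])
        (use r in \<open>auto simp: norm_vector_scalar_mult norm_mult mult_ac\<close>)
    then show ?thesis
      by (simp add: F_def mult.commute)
  qed
  have ball_sub: "ball 0 (r / \<rho>) \<subseteq> {z. norm (z *s x) < r}" if "norm x \<le> \<rho>" for x :: "complex ^ 'n"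
  proof
    fix z :: complex assume "z \<in> ball 0 (r / \<rho>)"
    then have "norm z * \<rho> < r"
      using \<rho> by (simp add: field_simps)
    moreover have "norm z * norm x \<le> norm z * \<rho>"
      using that by (intro mult_left_mono) auto
    ultimately show "z \<in> {z. norm (z *s x) < r}"
      by (simp add: norm_vector_scalar_mult)
  qed
  have gt1: "1 < r / \<rho>"
    using \<rho> by simp
  have bound1: "norm (F j x) \<le> M" if x: "norm x \<le> \<rho>" for j x
  proof -
    have sub: "cball 0 1 \<subseteq> ball (0::complex) (r / \<rho>)"
      using gt1 by auto
    have hol: "(\<lambda>z. f (z *s x)) holomorphic_on cball 0 1"
      by (rule holomorphic_on_subset[OF line0 order_trans[OF sub ball_sub[OF x]]])
    \<comment> \<open>Cauchy's inequality on the unit circle, where \<open>z *s x\<close> stays in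
      the ball on which \<open>M\<close> bounds \<open>f\<close>.\<close>
    have "norm ((deriv ^^ j) (\<lambda>z. f (z *s x)) 0) \<le> fact j * M / 1 ^ j"
    proof (rule Cauchy_inequality)
      show "(\<lambda>z. f (z *s x)) holomorphic_on ball 0 1"
        by (rule holomorphic_on_subset[OF hol]) auto
      show "continuous_on (cball 0 1) (\<lambda>z. f (z *s x))"
        by (rule holomorphic_on_imp_continuous_on[OF hol])
    qed (use x in \<open>auto intro!: M simp: norm_vector_scalar_mult\<close>)
    then show ?thesis
      by (simp add: F_def norm_divide field_simps)
  qed
  show thesis
  proof
    show "homogeneous_taylor f F \<rho> M"
    proof
      show "\<rho> > 0" by fact
      show "F j (c *s x) = c ^ j * F j x" for j c x
        by (rule scale)
      show "(\<lambda>z. f (a + z *s b)) holomorphic_on {z. norm (a + z *s b) < \<rho>}" for a b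
        by (rule holomorphic_on_subset[OF line]) (use \<rho> in auto)
      show "(\<lambda>j. F j x) sums f x" if x: "norm x \<le> \<rho>" for x
      proof -
        \<comment> \<open>The Taylor series of the slice, evaluated at \<open>z = 1\<close>.\<close>
        have "(\<lambda>j. (deriv ^^ j) (\<lambda>z. f (z *s x)) 0 / fact j * (1 - 0) ^ j) sums f (1 *s x)"
          by (rule holomorphic_power_series[OF holomorphic_on_subset[OF line0 ball_sub[OF x]]])
            (use gt1 in auto)
        then show ?thesis
          by (simp add: F_def)
      qed
      show "norm (F j x) \<le> M * (norm x / \<rho>) ^ j" for j x
      proof (cases "x = 0")
        \<comment> \<open>The origin cannot be rescaled to norm \<open>\<rho>\<close>. For
          \<open>j = 0\<close> the bound reads \<open>M\<close>, as \<open>0 ^ 0 = 1\<close>; for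
          larger \<open>j\<close>, homogeneity with factor 0 gives \<open>F j 0 = 0\<close>.\<close>
        case True
        show ?thesis
        proof (cases j)
          case 0
          then show ?thesis using bound1[of x] True \<rho> by simp
        next
          case (Suc n)
          then show ?thesis using scale[of j 0 x] True by simp
        qed
      next
        case False
        \<comment> \<open>Rescale \<open>x\<close> to norm \<open>\<rho>\<close>, where the bound
          \<open>M\<close> holds, and return by homogeneity.\<close>
        define c where "c = norm x / \<rho>"
        have c: "c > 0" "norm ((1 / c) *\<^sub>R x) = \<rho>"
          using False \<rho> by (auto simp: c_def)
        have "x = of_real c *s ((1 / c) *\<^sub>R x)"
          using c by (simp add: of_real_vector_scalar_mult)
        then have "norm (F j x) = c ^ j * norm (F j ((1 / c) *\<^sub>R x))"
          using c scale[of j "of_real c" "(1 / c) *\<^sub>R x"] by (simp add: norm_mult norm_power)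
        also have "\<dots> \<le> c ^ j * M"
          using c by (intro mult_left_mono bound1) auto
        finally show ?thesis
          by (simp add: c_def mult.commute)
      qed
    qed
  qed
qed

section \<open>Tail estimates and polynomiality of the Taylor terms\<close>

context homogeneous_taylor
begin

lemma M_nonneg: "M \<ge> 0"
  using order_trans[OF norm_ge_zero bound[of 0]] by simp

text \<open>The tail is dominated by a geometric series of ratio
  \<open>norm x / \<rho> \<le> 1 / 2\<close>, hence the factor 2.\<close>

lemma remainder:
  assumes "norm x \<le> \<rho> / 2"
  shows "norm (f x - (\<Sum>i<j. F i x)) \<le> 2 * M * (norm x / \<rho>) ^ j"
proof -
  define q where "q = norm x / \<rho>"
  have q: "0 \<le> q" "q \<le> 1 / 2"
    using assms radius_pos by (auto simp: q_def field_simps)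
  have "(\<lambda>i. F (i + j) x) sums (f x - (\<Sum>i<j. F i x))"
    using sums_split_initial_segment[OF sums] assms radius_pos by simp
  then have "norm (f x - (\<Sum>i<j. F i x)) = norm (\<Sum>i. F (i + j) x)"
    by (simp add: sums_iff)
  also have "\<dots> \<le> (\<Sum>i. M * q ^ j * q ^ i)"
  proof (rule norm_suminf_le)
    show "summable (\<lambda>i. M * q ^ j * q ^ i)"
      using q by (intro summable_mult summable_geometric) auto
    show "norm (F (i + j) x) \<le> M * q ^ j * q ^ i" for i
      using bound[of "i + j" x] by (simp add: q_def power_add mult_ac)
  qed
  also have "\<dots> = M * q ^ j * (1 / (1 - q))"
    using q by (subst suminf_mult) (auto simp: suminf_geometric intro!: summable_geometric)
  also have "\<dots> \<le> M * q ^ j * 2"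
    using q M_nonneg by (intro mult_left_mono) (auto simp: field_simps)
  finally show ?thesis
    by (simp add: q_def mult_ac)
qed

text \<open>Each \<open>F j\<close> is a locally uniform limit of rescaled remainders of \<open>f\<close>, which avoids
  differentiating under a Cauchy integral.\<close>

lemma holomorphic_on_line: "(\<lambda>y. F j (a + y *s b)) holomorphic_on UNIV"
\<comment> \<open>The rescaled remainder contains the lower terms, whose holomorphy is the induction
  hypothesis.\<close>
proof (induction j rule: less_induct)
  case (less j)
  have "(\<lambda>y. F j (a + y *s b)) holomorphic_on ball 0 R" if "R > 0" for R
  proof -
    define B where "B = norm a + R * norm b"
    have B: "norm (a + y *s b) \<le> B" if "y \<in> cball 0 R" for y
    proof -
      have "norm (y *s b) \<le> R * norm b"
        using that by (auto simp: norm_vector_scalar_mult intro!: mult_right_mono)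
      then show ?thesis
        using norm_triangle_ineq[of a "y *s b"] by (simp add: B_def)
    qed
    have "B \<ge> 0"
      using that by (simp add: B_def)
    \<comment> \<open>By homogeneity the subtracted sum is the Taylor sum below degree
      \<open>j\<close> at the point scaled by \<open>s\<close>; as \<open>s\<close> decreases to 0,
      only the degree \<open>j\<close> term survives.\<close>
    define G where "G s y = (f (of_real s *s (a + y *s b)) -
        (\<Sum>i<j. of_real s ^ i * F i (a + y *s b))) / of_real s ^ j" for s :: real and y
    have "((\<lambda>s. s * B) \<longlongrightarrow> 0 * B) (at_right 0)"
      by (intro tendsto_intros)
    then have "\<forall>\<^sub>F s in at_right 0. s * B < \<rho> / 2"
      by (rule order_tendstoD) (use radius_pos in simp)
    then have small: "\<forall>\<^sub>F s in at_right 0. s > 0 \<and> s * B < \<rho> / 2"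
      using eventually_at_right_less by (rule eventually_conj[rotated])
    have scaled: "norm (of_real s *s (a + y *s b)) \<le> s * B"
      if "s > 0" "y \<in> cball 0 R" for s y
      using that B[of y] unfolding norm_vector_scalar_mult by (simp add: mult_left_mono)
    show ?thesis
    proof (rule holomorphic_uniform_limit)
      show "\<forall>\<^sub>F s in at_right 0. continuous_on (cball 0 R) (G s) \<and> G s holomorphic_on ball 0 R"
        using small
      proof eventually_elim
        case (elim s)
        have "(\<lambda>y. f (of_real s *s a + y *s (of_real s *s b))) holomorphic_on cball 0 R"
        proof (rule holomorphic_on_subset[OF line])
          show "cball 0 R \<subseteq> {y. norm (of_real s *s a + y *s (of_real s *s b)) < \<rho>}"
          proof
            fix y :: complex assume "y \<in> cball 0 R"
            then show "y \<in> {y. norm (of_real s *s a + y *s (of_real s *s b)) < \<rho>}"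
              using scaled[of s y] elim radius_pos by (simp add: algebra_simps vector_add_ldistrib)
          qed
        qed
        then have "(\<lambda>y. f (of_real s *s (a + y *s b))) holomorphic_on cball 0 R"
          by (simp add: vector_add_ldistrib mult.commute)
        moreover have "(\<lambda>y. F i (a + y *s b)) holomorphic_on cball 0 R" if "i < j" for i
          using holomorphic_on_subset[OF less[OF that]] by simp
        ultimately have "G s holomorphic_on cball 0 R"
          unfolding G_def using elim by (intro holomorphic_intros) auto
        then show ?case
          by (meson ball_subset_cball holomorphic_on_imp_continuous_on holomorphic_on_subset)
      qed
      show "uniform_limit (cball 0 R) G (\<lambda>y. F j (a + y *s b)) (at_right 0)"
        unfolding uniform_limit_iff
      proof (intro allI impI)
        fix e :: real assume "e > 0"
        have "((\<lambda>s. 2 * M * (B / \<rho>) ^ Suc j * s) \<longlongrightarrow> 2 * M * (B / \<rho>) ^ Suc j * 0) (at_right 0)"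
          by (intro tendsto_intros)
        then have "\<forall>\<^sub>F s in at_right 0. 2 * M * (B / \<rho>) ^ Suc j * s < e"
          by (rule order_tendstoD) (use \<open>e > 0\<close> in simp)
        with small show "\<forall>\<^sub>F s in at_right 0. \<forall>y\<in>cball 0 R. dist (G s y) (F j (a + y *s b)) < e"
        proof eventually_elim
          case (elim s)
          show ?case
          proof
            fix y :: complex assume y: "y \<in> cball 0 R"
            define x where "x = of_real s *s (a + y *s b)"
            have x: "norm x \<le> s * B"
              using scaled[of s y] y elim by (simp add: x_def)
            have "G s y = (f x - (\<Sum>i<j. F i x)) / of_real s ^ j"
              by (simp only: G_def x_def scale)
            moreover have "F j (a + y *s b) = F j x / of_real s ^ j"
              unfolding x_def scale using elim by simp
            \<comment> \<open>Subtracting \<open>F j\<close> too leaves a remainder of order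
              \<open>Suc j\<close>, so one factor \<open>s\<close> survives the division by
              \<open>s ^ j\<close>, uniformly in \<open>y\<close>.\<close>
            ultimately have "G s y - F j (a + y *s b) = (f x - (\<Sum>i<Suc j. F i x)) / of_real s ^ j"
              by (simp add: diff_divide_distrib add_divide_distrib)
            then have "dist (G s y) (F j (a + y *s b)) = norm (f x - (\<Sum>i<Suc j. F i x)) / s ^ j"
              using elim by (simp add: dist_norm norm_divide norm_power)
            also have "\<dots> \<le> (2 * M * (norm x / \<rho>) ^ Suc j) / s ^ j"
              using x elim by (intro divide_right_mono remainder) auto
            also have "\<dots> \<le> (2 * M * (s * B / \<rho>) ^ Suc j) / s ^ j"
              using x elim radius_pos M_nonneg
              by (intro divide_right_mono mult_left_mono power_mono) auto
            also have "\<dots> = 2 * M * (B / \<rho>) ^ Suc j * s"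
              using elim by (simp add: field_simps power_mult_distrib)
            finally show "dist (G s y) (F j (a + y *s b)) < e"
              using elim by linarith
          qed
        qed
      qed
    qed auto
  qed
  note hol = this
  show ?case
  proof (rule holomorphic_on_subset)
    have "(\<lambda>y. F j (a + y *s b)) holomorphic_on (\<Union>R\<in>{0<..}. ball 0 R)"
      by (rule holomorphic_on_UN_open) (use hol in auto)
    then show "(\<lambda>y. F j (a + y *s b)) holomorphic_on (\<Union>R\<in>{0<..}. ball 0 R)" .
    show "UNIV \<subseteq> (\<Union>R\<in>{0<..}. ball (0::complex) R)"
    proof
      fix y :: complex
      have "y \<in> ball 0 (norm y + 1)"
        by simp
      then show "y \<in> (\<Union>R\<in>{0<..}. ball 0 R)"
        by (rule UN_I[rotated]) (simp add: add_nonneg_pos)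
    qed
  qed
qed

text \<open>On a coordinate line \<open>F j\<close> is entire and grows at most like
  \<open>norm y ^ j\<close>, so Liouville's theorem makes it a polynomial of degree at most
  \<open>j\<close>.\<close>

lemma separately_polynomial: "separately_polynomial j (F j)"
  unfolding separately_polynomial_def
proof (intro allI)
  fix i :: 'n and x :: "complex ^ 'n"
  define a where "a = (\<chi> l. if l = i then 0 else x $ l)"
  define b where "b = (axis i 1 :: complex ^ 'n)"
  define h where "h y = F j (a + y *s b)" for y
  have eq: "(\<chi> l. if l = i then y else x $ l) = a + y *s b" for y
    by (auto simp: a_def b_def vec_eq_iff axis_def)
  have "norm (h y) \<le> M * ((norm a + norm b) / \<rho>) ^ j * norm y ^ j" if "1 \<le> norm y" for y
  proof -
    have "norm a * 1 \<le> norm a * norm y"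
      using that by (intro mult_left_mono) auto
    then have "norm (a + y *s b) \<le> (norm a + norm b) * norm y"
      using norm_triangle_ineq[of a "y *s b"] by (simp add: norm_vector_scalar_mult algebra_simps)
    then have "M * (norm (a + y *s b) / \<rho>) ^ j \<le> M * ((norm a + norm b) * norm y / \<rho>) ^ j"
      using radius_pos M_nonneg by (intro mult_left_mono power_mono divide_right_mono) auto
    then show ?thesis
      using order_trans[OF bound] by (simp add: h_def power_mult_distrib power_divide)
  qed
  then have "h y = (\<Sum>k\<le>j. (deriv ^^ k) h 0 / fact k * y ^ k)" for y
    using holomorphic_on_line unfolding h_def by (intro Liouville_polynomial)
  then have "h y = poly (\<Sum>k\<le>j. monom ((deriv ^^ k) h 0 / fact k) k) y" for y
    by (simp add: poly_sum poly_monom)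
  moreover have "degree (\<Sum>k\<le>j. monom ((deriv ^^ k) h 0 / fact k) k) \<le> j"
    by (intro degree_sum_le) (auto intro: order_trans[OF degree_monom_le])
  ultimately show "\<exists>q. degree q \<le> j \<and> (\<forall>y. F j (\<chi> l. if l = i then y else x $ l) = poly q y)"
    unfolding eq h_def by blast
qed

lemma homogeneous_expansion: "homogeneous_expansion f F"
  unfolding homogeneous_expansion_def
proof
  show "\<forall>j. homogeneous_polynomial j (F j)"
    using homogeneous_polynomial_of_separately_polynomial separately_polynomial scale by blast
  show "\<forall>\<^sub>F x in nhds 0. (\<lambda>j. F j x) sums f x"
    unfolding eventually_nhds_metric using radius_pos sums by (auto intro!: exI[of _ \<rho>])
qed

lemma homogeneous_part_eq: "homogeneous_part f = F"
  unfolding homogeneous_part_def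
  using homogeneous_expansion homogeneous_expansion_unique by blast

end

subsection \<open>The initial form as a blow-up limit\<close>

lemma continuous_on_homogeneous_polynomial:
  assumes "homogeneous_polynomial d p"
  shows "continuous_on S p"
proof -
  obtain c where "p = (\<lambda>x. \<Sum>\<alpha>\<in>multi_indices d. c \<alpha> * (\<Prod>i\<in>UNIV. (x $ i) ^ \<alpha> i))"
    using assms by (auto simp: homogeneous_polynomial_def)
  then show ?thesis
    by (auto intro!: continuous_intros)
qed

context
  fixes f :: "complex ^ 'n \<Rightarrow> complex"
  assumes germ: "holomorphic_germ f" and nonzero: "nonzero_germ f"
begin

lemma homogeneous_polynomial_initial_form: "homogeneous_polynomial (ord0 f) (initial_form f)"
proof -
  obtain F \<rho> M where "homogeneous_taylor f F \<rho> M"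
    using germ holomorphic_at_0_imp_homogeneous_taylor unfolding holomorphic_germ_def by blast
  then interpret homogeneous_taylor f F \<rho> M .
  show ?thesis
    using homogeneous_expansion
    by (simp add: initial_form_def homogeneous_part_eq homogeneous_expansion_def)
qed

text \<open>If all terms vanished, the expansion would make \<open>f\<close> zero near 0; so the
  minimum in \<open>ord0\<close> is attained.\<close>

lemma initial_form_nonzero: "initial_form f \<noteq> (\<lambda>_. 0)"
proof -
  obtain F \<rho> M where "homogeneous_taylor f F \<rho> M"
    using germ holomorphic_at_0_imp_homogeneous_taylor unfolding holomorphic_germ_def by blast
  then interpret homogeneous_taylor f F \<rho> M .
  have "\<exists>j. F j \<noteq> (\<lambda>_. 0)"
  proof (rule ccontr)
    assume "\<not> (\<exists>j. F j \<noteq> (\<lambda>_. 0))"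
    then have F: "F j x = 0" for j x
      by metis
    have "\<forall>\<^sub>F x in nhds 0. (\<lambda>j. F j x) sums f x"
      using homogeneous_expansion by (simp add: homogeneous_expansion_def)
    then have "\<forall>\<^sub>F x in nhds 0. f x = 0"
      by (rule eventually_mono) (auto simp: F sums_iff)
    then show False
      using nonzero by (simp add: nonzero_germ_def)
  qed
  then show ?thesis
    unfolding initial_form_def ord0_def homogeneous_part_eq by (rule LeastI_ex)
qed

text \<open>The degree 0 term is the constant \<open>f 0 = 0\<close>. Positivity later permits
  taking roots of order \<open>ord0\<close>.\<close>

lemma ord0_pos: "ord0 f > 0"
proof (rule ccontr)
  obtain F \<rho> M where "homogeneous_taylor f F \<rho> M"
    using germ holomorphic_at_0_imp_homogeneous_taylor unfolding holomorphic_germ_def by blast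
  then interpret homogeneous_taylor f F \<rho> M .
  assume "\<not> ord0 f > 0"
  then have init: "initial_form f = F 0"
    by (simp add: initial_form_def homogeneous_part_eq)
  have F0: "F 0 x = F 0 0" for x
    using scale[of 0 0 x] by simp
  have "F j 0 = 0" if "j \<noteq> 0" for j
    using scale[of j 0 0] that by (simp add: power_0_left)
  then have "(\<lambda>j. F j 0) sums F 0 0"
    using sums_finite[of "{0}" "\<lambda>j. F j 0"] by simp
  moreover have "(\<lambda>j. F j 0) sums 0"
    using sums[of 0] radius_pos germ by (simp add: holomorphic_germ_def)
  ultimately have "F 0 0 = 0"
    by (rule sums_unique2)
  then show False
    using initial_form_nonzero init F0 by auto
qed

text \<open>Terms below the order vanish, and the remainder beyond the initial form, divided by
  \<open>s j ^ ord0 f\<close>, is of size \<open>s j\<close>. Continuity of the initial form absorbs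
  the moving point \<open>w j\<close>.\<close>

lemma blow_up_tendsto:
  assumes s: "\<And>j. s j > 0" "s \<longlonglongrightarrow> 0" and w: "w \<longlonglongrightarrow> v"
  shows "(\<lambda>j. f (s j *\<^sub>R w j) /\<^sub>R s j ^ ord0 f) \<longlonglongrightarrow> initial_form f v"
proof -
  obtain F \<rho> M where "homogeneous_taylor f F \<rho> M"
    using germ holomorphic_at_0_imp_homogeneous_taylor unfolding holomorphic_germ_def by blast
  then interpret homogeneous_taylor f F \<rho> M .
  define m where "m = ord0 f"
  have low: "F i = (\<lambda>_. 0)" if "i < m" for i
    using not_less_Least[of i "\<lambda>j. homogeneous_part f j \<noteq> (\<lambda>_. 0)"] that
    by (auto simp: m_def ord0_def homogeneous_part_eq)
  have init: "initial_form f = F m"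
    by (simp add: m_def initial_form_def homogeneous_part_eq)
  have sw: "(\<lambda>j. s j *\<^sub>R w j) \<longlonglongrightarrow> 0"
    using tendsto_scaleR[OF s(2) w] by simp
  then have "\<forall>\<^sub>F j in sequentially. norm (s j *\<^sub>R w j) < \<rho> / 2"
    using radius_pos by (intro order_tendstoD[OF tendsto_norm_zero]) auto
  then have "\<forall>\<^sub>F j in sequentially. norm (f (s j *\<^sub>R w j) /\<^sub>R s j ^ m - F m (w j))
      \<le> 2 * M * (norm (w j) / \<rho>) ^ Suc m * s j"
  proof eventually_elim
    case (elim j)
    have "F m (s j *\<^sub>R w j) = of_real (s j) ^ m * F m (w j)"
      by (simp add: scale flip: of_real_vector_scalar_mult)
    moreover have "(\<Sum>i<Suc m. F i x) = F m x" for x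
      by (simp add: low)
    ultimately have "f (s j *\<^sub>R w j) /\<^sub>R s j ^ m - F m (w j) =
        (f (s j *\<^sub>R w j) - (\<Sum>i<Suc m. F i (s j *\<^sub>R w j))) /\<^sub>R s j ^ m"
      using s(1)[of j] by (simp add: scaleR_conv_of_real field_simps)
    then have "norm (f (s j *\<^sub>R w j) /\<^sub>R s j ^ m - F m (w j)) =
        norm (f (s j *\<^sub>R w j) - (\<Sum>i<Suc m. F i (s j *\<^sub>R w j))) / s j ^ m"
      using s(1)[of j] by (simp add: divide_inverse mult.commute)
    also have "\<dots> \<le> 2 * M * (norm (s j *\<^sub>R w j) / \<rho>) ^ Suc m / s j ^ m"
      using elim s(1)[of j] by (intro divide_right_mono remainder) auto
    also have "\<dots> = 2 * M * (norm (w j) / \<rho>) ^ Suc m * s j"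
      using s(1)[of j] by (simp add: field_simps power_mult_distrib)
    finally show ?case .
  qed
  moreover have "(\<lambda>j. 2 * M * (norm (w j) / \<rho>) ^ Suc m * s j) \<longlonglongrightarrow>
      2 * M * (norm v / \<rho>) ^ Suc m * 0"
    using radius_pos by (intro tendsto_intros w s(2)) auto
  ultimately have "(\<lambda>j. f (s j *\<^sub>R w j) /\<^sub>R s j ^ m - F m (w j)) \<longlonglongrightarrow> 0"
    unfolding mult_zero_right by (rule Lim_null_comparison)
  moreover have "isCont (F m) v"
    using continuous_on_homogeneous_polynomial[OF homogeneous_polynomial_initial_form, of UNIV]
    by (simp add: init continuous_on_eq_continuous_at)
  then have "(\<lambda>j. F m (w j)) \<longlonglongrightarrow> F m v"
    using w by (rule isCont_tendsto_compose)
  ultimately have "(\<lambda>j. (f (s j *\<^sub>R w j) /\<^sub>R s j ^ m - F m (w j)) + F m (w j)) \<longlonglongrightarrow> 0 + F m v"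
    by (rule tendsto_add)
  then show ?thesis
    by (simp add: m_def init[unfolded m_def])
qed

end

subsection \<open>Comparison of the initial forms\<close>

text \<open>A convergent sequence together with its limit is compact, so uniform convergence applies
  along it.\<close>

lemma has_pseudo_derivative_tendsto:
  fixes \<psi> :: "'a::euclidean_space \<Rightarrow> 'b::euclidean_space"
  assumes \<phi>: "has_pseudo_derivative U \<phi> \<psi> t" and "isCont \<psi> v" and w: "w \<longlonglongrightarrow> v"
  shows "(\<lambda>j. \<phi> (t j *\<^sub>R w j) /\<^sub>R t j) \<longlonglongrightarrow> \<psi> v"
proof -
  have "compact (insert v (range w))"
    using w by (rule compact_sequence_with_limit)
  then have "uniform_limit (insert v (range w)) (\<lambda>j v. \<phi> (t j *\<^sub>R v) /\<^sub>R t j) \<psi> sequentially"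
    using \<phi> unfolding has_pseudo_derivative_def by blast
  then have "(\<lambda>j. \<phi> (t j *\<^sub>R w j) /\<^sub>R t j - \<psi> (w j)) \<longlonglongrightarrow> 0"
    unfolding tendsto_iff uniform_limit_iff by (auto simp: dist_norm elim!: eventually_mono)
  moreover have "(\<lambda>j. \<psi> (w j)) \<longlonglongrightarrow> \<psi> v"
    by (rule isCont_tendsto_compose) fact+
  ultimately have "(\<lambda>j. (\<phi> (t j *\<^sub>R w j) /\<^sub>R t j - \<psi> (w j)) + \<psi> (w j)) \<longlonglongrightarrow> 0 + \<psi> v"
    by (rule tendsto_add)
  then show ?thesis
    by simp
qed

text \<open>The second sequence is the first times \<open>t j ^ (m - k)\<close>, which tends to 0.
  This compares the orders of \<open>f\<close> and \<open>g\<close>.\<close>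

lemma power_rescaled_limit_eq_0:
  fixes h :: "nat \<Rightarrow> 'a::real_normed_vector"
  assumes t: "\<And>j. t j > 0" "t \<longlonglongrightarrow> 0"
    and lim: "(\<lambda>j. h j /\<^sub>R t j ^ m) \<longlonglongrightarrow> a" and "k < m"
    and lim': "(\<lambda>j. h j /\<^sub>R t j ^ k) \<longlonglongrightarrow> b"
  shows "b = 0"
proof -
  have "(\<lambda>j. t j ^ (m - k) *\<^sub>R (h j /\<^sub>R t j ^ m)) \<longlonglongrightarrow> 0 ^ (m - k) *\<^sub>R a"
    by (intro tendsto_intros t lim)
  moreover have "t j ^ (m - k) *\<^sub>R (h j /\<^sub>R t j ^ m) = h j /\<^sub>R t j ^ k" for j
  proof -
    have "t j ^ m = t j ^ (m - k) * t j ^ k"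
      using \<open>k < m\<close> by (simp flip: power_add)
    then show ?thesis
      using t(1)[of j] by simp
  qed
  ultimately have "(\<lambda>j. h j /\<^sub>R t j ^ k) \<longlonglongrightarrow> 0 ^ (m - k) *\<^sub>R a"
    by (simp only:)
  moreover have "0 ^ (m - k) *\<^sub>R a = 0"
    using \<open>k < m\<close> by simp
  ultimately have "(\<lambda>j. h j /\<^sub>R t j ^ k) \<longlonglongrightarrow> 0"
    by (simp only:)
  then show ?thesis
    using lim' LIMSEQ_unique by blast
qed

lemma homeomorphic_milnor_fibre_scale:
  fixes p :: "complex ^ 'n \<Rightarrow> complex"
  assumes p: "\<And>z x. p (z *s x) = z ^ k * p x" and "k > 0" "c \<noteq> 0"
  shows "{x. p x = c} homeomorphic milnor_fibre p"
proof -
  \<comment> \<open>A \<open>k\<close>-th root of \<open>c\<close>; scaling by it carries the fibre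
    over 1 to the fibre over \<open>c\<close>.\<close>
  define b where "b = exp (Ln c / of_nat k)"
  have b: "b ^ k = c" "b \<noteq> 0"
    using assms by (simp_all add: b_def exp_divide_power_eq)
  have cont: "continuous_on S (\<lambda>x. z *s x)" for z :: complex and S :: "(complex ^ 'n) set"
    unfolding vector_scalar_mult_def by (intro continuous_intros)
  have "homeomorphism {x. p x = c} (milnor_fibre p) (\<lambda>x. inverse b *s x) (\<lambda>x. b *s x)"
  proof (rule homeomorphismI)
    show "(\<lambda>x. inverse b *s x) ` {x. p x = c} \<subseteq> milnor_fibre p"
      using b \<open>c \<noteq> 0\<close> by (auto simp: p milnor_fibre_def power_inverse)
    show "(\<lambda>x. b *s x) ` milnor_fibre p \<subseteq> {x. p x = c}"
      using b by (auto simp: p milnor_fibre_def)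
  qed (use b in \<open>auto intro: cont\<close>)
  then show ?thesis
    unfolding homeomorphic_def by blast
qed

section \<open>Rescaling the composition and matching the fibres\<close>

theorem proposition2p5:
  fixes f g :: "complex ^ 'n \<Rightarrow> complex"
    and \<phi> d\<phi> :: "complex ^ 'n \<Rightarrow> complex ^ 'n"
    and \<Phi> d\<Phi> :: "complex \<Rightarrow> complex"
    and U :: "(complex ^ 'n) set" and V :: "complex set"
    and t :: "nat \<Rightarrow> real" and k :: nat
  assumes "holomorphic_germ f" and "nonzero_germ f"
    and "holomorphic_germ g" and "nonzero_germ g"
    and "k = ord0 g"
    and "\<phi> 0 = 0" and "\<Phi> 0 = 0"
    and "\<forall>\<^sub>F x in nhds 0. f x = (\<Phi> \<circ> g \<circ> \<phi>) x"
    and "\<And>j. t j > 0" and "t \<longlonglongrightarrow> 0"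
    and "has_pseudo_derivative U \<phi> d\<phi> t"
    and "has_pseudo_derivative V \<Phi> d\<Phi> (\<lambda>j. t j ^ k)"
    and "homeomorphic_map euclidean euclidean d\<phi>"
    and "homeomorphic_map euclidean euclidean d\<Phi>"
  shows "milnor_fibre (initial_form f) homotopy_eqv milnor_fibre (initial_form g)"
proof -
  let ?p = "initial_form f" and ?q = "initial_form g"
  define m where "m = ord0 f"
  note t = assms(9,10)
  obtain d\<phi>' where "homeomorphic_maps euclidean euclidean d\<phi> d\<phi>'"
    using assms(13) homeomorphic_map_maps by blast
  then have cont: "continuous_on UNIV d\<phi>" "continuous_on UNIV d\<phi>'"
    and inv: "\<And>x. d\<phi>' (d\<phi> x) = x" "\<And>x. d\<phi> (d\<phi>' x) = x"
    by (auto simp: homeomorphic_maps_def)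
  obtain d\<Phi>' where "homeomorphic_maps euclidean euclidean d\<Phi> d\<Phi>'"
    using assms(14) homeomorphic_map_maps by blast
  then have cont\<Phi>: "continuous_on UNIV d\<Phi>"
    and inv\<Phi>: "\<And>x. d\<Phi>' (d\<Phi> x) = x" "\<And>x. d\<Phi> (d\<Phi>' x) = x"
    by (auto simp: homeomorphic_maps_def)
  have d\<Phi>0: "d\<Phi> 0 = 0"
    using assms(12) by (simp add: has_pseudo_derivative_def)
  have lim_m: "(\<lambda>j. f (t j *\<^sub>R v) /\<^sub>R t j ^ m) \<longlonglongrightarrow> ?p v" for v
    using blow_up_tendsto[OF assms(1,2) t tendsto_const] by (simp add: m_def)
  have lim_k: "(\<lambda>j. f (t j *\<^sub>R v) /\<^sub>R t j ^ k) \<longlonglongrightarrow> d\<Phi> (?q (d\<phi> v))" for v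
  proof -
    \<comment> \<open>Now \<open>\<phi> (t j *\<^sub>R v)\<close> is
      \<open>t j *\<^sub>R w j\<close> with \<open>w\<close> convergent, so \<open>g\<close> is
      blown up along moving points.\<close>
    define w where "w j = \<phi> (t j *\<^sub>R v) /\<^sub>R t j" for j
    have "w \<longlonglongrightarrow> d\<phi> v"
      unfolding w_def using cont(1) assms(11)
      by (intro has_pseudo_derivative_tendsto) (auto simp: continuous_on_eq_continuous_at)
    then have "(\<lambda>j. g (t j *\<^sub>R w j) /\<^sub>R t j ^ k) \<longlonglongrightarrow> ?q (d\<phi> v)"
      using blow_up_tendsto[OF assms(3,4) t] assms(5) by blast
    \<comment> \<open>The blown-up values of \<open>g\<close> converge, so \<open>\<Phi>\<close> is
      rescaled along them at scale \<open>t j ^ k\<close>.\<close>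
    then have "(\<lambda>j. \<Phi> (t j ^ k *\<^sub>R (g (t j *\<^sub>R w j) /\<^sub>R t j ^ k)) /\<^sub>R t j ^ k)
        \<longlonglongrightarrow> d\<Phi> (?q (d\<phi> v))"
      using cont\<Phi> assms(12)
      by (intro has_pseudo_derivative_tendsto) (auto simp: continuous_on_eq_continuous_at)
    moreover have "t j ^ k *\<^sub>R (g (t j *\<^sub>R w j) /\<^sub>R t j ^ k) = g (\<phi> (t j *\<^sub>R v))" for j
      using t(1)[of j] by (simp add: w_def)
    ultimately have "(\<lambda>j. \<Phi> (g (\<phi> (t j *\<^sub>R v))) /\<^sub>R t j ^ k) \<longlonglongrightarrow> d\<Phi> (?q (d\<phi> v))"
      by simp
    moreover have "(\<lambda>j. t j *\<^sub>R v) \<longlonglongrightarrow> 0"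
      using tendsto_scaleR[OF t(2) tendsto_const] by simp
    then have "\<forall>\<^sub>F j in sequentially. f (t j *\<^sub>R v) = (\<Phi> \<circ> g \<circ> \<phi>) (t j *\<^sub>R v)"
      using assms(8) by (rule eventually_compose_filterlim[rotated])
    then have "\<forall>\<^sub>F j in sequentially. \<Phi> (g (\<phi> (t j *\<^sub>R v))) /\<^sub>R t j ^ k = f (t j *\<^sub>R v) /\<^sub>R t j ^ k"
      by eventually_elim simp
    ultimately show ?thesis
      by (rule Lim_transform_eventually)
  qed
  have "m = k"
  proof (rule linorder_cases)
    \<comment> \<open>Convergence at the higher power \<open>k\<close> forces the limit at power
      \<open>m\<close>, the initial form of \<open>f\<close>, to vanish.\<close>
    assume "m < k"
    then have "?p v = 0" for v
      using power_rescaled_limit_eq_0[OF t lim_k _ lim_m] by blast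
    then show ?thesis
      using initial_form_nonzero[OF assms(1,2)] by auto
  next
    assume "k < m"
    then have "d\<Phi> (?q (d\<phi> v)) = 0" for v
      using power_rescaled_limit_eq_0[OF t lim_m _ lim_k] by blast
    \<comment> \<open>Surjectivity of \<open>d\<phi>\<close> reaches every \<open>x\<close>;
      injectivity of \<open>d\<Phi>\<close>, which fixes 0, removes the outer map.\<close>
    then have "?q x = 0" for x
      by (metis d\<Phi>0 inv(2) inv\<Phi>(1))
    then show ?thesis
      using initial_form_nonzero[OF assms(3,4)] by auto
  qed
  then have p_eq: "?p v = d\<Phi> (?q (d\<phi> v))" for v
    using lim_m[of v] lim_k[of v] by (auto intro: LIMSEQ_unique)
  \<comment> \<open>\<open>d\<phi>\<close> carries the Milnor fibre of \<open>?p\<close> onto the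
    fibre of \<open>?q\<close> over this value, nonzero because \<open>d\<Phi>\<close> fixes
    0.\<close>
  define c where "c = d\<Phi>' 1"
  have "c \<noteq> 0"
    using inv\<Phi>(2)[of 1] d\<Phi>0 by (auto simp: c_def)
  have "homeomorphism (milnor_fibre ?p) {x. ?q x = c} d\<phi> d\<phi>'"
  proof (rule homeomorphismI)
    show "d\<phi> ` milnor_fibre ?p \<subseteq> {x. ?q x = c}"
      by (auto simp: milnor_fibre_def p_eq c_def) (metis inv\<Phi>(1))
    show "d\<phi>' ` {x. ?q x = c} \<subseteq> milnor_fibre ?p"
      by (auto simp: milnor_fibre_def p_eq c_def inv inv\<Phi>)
  qed (use inv in \<open>auto intro: continuous_on_subset[OF cont(1)] continuous_on_subset[OF cont(2)]\<close>)
  then have "milnor_fibre ?p homeomorphic {x. ?q x = c}"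
    unfolding homeomorphic_def by blast
  also have "\<dots> homeomorphic milnor_fibre ?q"
    using homogeneous_polynomial_scale[OF homogeneous_polynomial_initial_form[OF assms(3,4)]]
      ord0_pos[OF assms(3,4)] \<open>c \<noteq> 0\<close> by (rule homeomorphic_milnor_fibre_scale)
  finally show ?thesis
    by (rule homeomorphic_imp_homotopy_eqv)
qed

end
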